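(* Let $\mathscr{F}\subseteq\mathscr{P}(\omega)$ be a nonempty $\omega$-closed family and let $(i_1,j_1,F_1)$ and $(i_2,j_2,F_2)$ be non-zero elements of the semigroup $\boldsymbol{B}_{\omega}^{\mathscr{F}}$ (i.e. $i_1,j_1,i_2,j_2\in\omega$ and $F_1,F_2\in\mathscr{F}$ are nonempty). Then: (i) $(i_1,j_1,F_1)\mathscr{R}(i_2,j_2,F_2)$ in $\boldsymbol{B}_{\omega}^{\mathscr{F}}$ if and only if $i_1=i_2$ and $F_1=F_2$; (ii) $(i_1,j_1,F_1)\mathscr{L}(i_2,j_2,F_2)$ in $\boldsymbol{B}_{\omega}^{\mathscr{F}}$ if and only if $j_1=j_2$ and $F_1=F_2$; (iii) $(i_1,j_1,F_1)\mathscr{H}(i_2,j_2,F_2)$ in $\boldsymbol{B}_{\omega}^{\mathscr{F}}$ if and only if $i_1=i_2$, $j_1=j_2$ and $F_1=F_2$, and hence all $\mathscr{H}$-classes of $\boldsymbol{B}_{\omega}^{\mathscr{F}}$ are one-element sets; (iv) $(i_1,j_1,F_1)\mathscr{D}(i_2,j_2,F_2)$ in $\boldsymbol{B}_{\omega}^{\mathscr{F}}$ if and only if $F_1=F_2$; (v) $(i_1,j_1,F_1)\mathscr{J}(i_2,j_2,F_2)$ in $\boldsymbol{B}_{\omega}^{\mathscr{F}}$ if and only if there exist $k_1,k_2\in\omega$ such that $F_1\subseteq -k_1+F_2$ and $F_2\subseteq -k_2+F_1$.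
   Context: $\omega$ is the set of non-negative integers, $\mathscr{P}(\omega)$ its power set. For an integer $n$ and $F\subseteq\omega$ put $n+F=\{n+k\colon k\in F\}\subseteq\mathbb{Z}$ (empty if $F=\varnothing$). A family $\mathscr{F}\subseteq\mathscr{P}(\omega)$ is $\omega$-closed if $F_1\cap(-n+F_2)\in\mathscr{F}$ for all $n\in\omega$ and $F_1,F_2\in\mathscr{F}$. For an $\omega$-closed family $\mathscr{F}$, the set $\boldsymbol{B}_{\omega}\times\mathscr{F}=\omega\times\omega\times\mathscr{F}$ carries the semigroup operation $$(i_1,j_1,F_1)\cdot(i_2,j_2,F_2)=\begin{cases}(i_1-j_1+i_2,\,j_2,\,(j_1-i_2+F_1)\cap F_2), & j_1\leqslant i_2;\\ (i_1,\,j_1-i_2+j_2,\,F_1\cap(i_2-j_1+F_2)), & j_1\geqslant i_2.\end{cases}$$ If $\varnothing\notin\mathscr{F}$, then $\boldsymbol{B}_{\omega}^{\mathscr{F}}=(\boldsymbol{B}_{\omega}\times\mathscr{F},\cdot)$. If $\varnothing\in\mathscr{F}$, then $\boldsymbol{I}=\{(i,j,\varnothing)\colon i,j\in\omega\}$ is an ideal and $\boldsymbol{B}_{\omega}^{\mathscr{F}}$ is the Rees quotient $(\boldsymbol{B}_{\omega}\times\mathscr{F},\cdot)/\boldsymbol{I}$, in which all $(i,j,\varnothing)$ are identified to a single zero element $\boldsymbol{0}$. $\mathscr{R},\mathscr{L},\mathscr{H},\mathscr{D},\mathscr{J}$ are Green's relations. *)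

theory Defs
  imports Main
begin

section \<open>Semigroups with explicit carrier and Green's relations\<close>

record 'a sgrp =
  carrier :: "'a set"
  mult :: "'a \<Rightarrow> 'a \<Rightarrow> 'a"

definition is_semigroup :: "'a sgrp \<Rightarrow> bool" where
  "is_semigroup S \<longleftrightarrow>
     (\<forall>a\<in>carrier S. \<forall>b\<in>carrier S. mult S a b \<in> carrier S) \<and>
     (\<forall>a\<in>carrier S. \<forall>b\<in>carrier S. \<forall>c\<in>carrier S.
        mult S (mult S a b) c = mult S a (mult S b c))"

text \<open>The principal ideals \<open>a S\<^sup>1\<close>, \<open>S\<^sup>1 a\<close> and \<open>S\<^sup>1 a S\<^sup>1\<close>, with the adjoined identity
  multiplied out.\<close>

definition right_ideal_gen :: "'a sgrp \<Rightarrow> 'a \<Rightarrow> 'a set" where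
  "right_ideal_gen S a = {a} \<union> {mult S a s | s. s \<in> carrier S}"

definition left_ideal_gen :: "'a sgrp \<Rightarrow> 'a \<Rightarrow> 'a set" where
  "left_ideal_gen S a = {a} \<union> {mult S s a | s. s \<in> carrier S}"

definition ideal_gen :: "'a sgrp \<Rightarrow> 'a \<Rightarrow> 'a set" where
  "ideal_gen S a = {a} \<union> {mult S a t | t. t \<in> carrier S} \<union> {mult S s a | s. s \<in> carrier S}
     \<union> {mult S (mult S s a) t | s t. s \<in> carrier S \<and> t \<in> carrier S}"

definition green_R :: "'a sgrp \<Rightarrow> ('a \<times> 'a) set" where
  "green_R S = {(a, b). a \<in> carrier S \<and> b \<in> carrier S \<and> right_ideal_gen S a = right_ideal_gen S b}"

definition green_L :: "'a sgrp \<Rightarrow> ('a \<times> 'a) set" where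
  "green_L S = {(a, b). a \<in> carrier S \<and> b \<in> carrier S \<and> left_ideal_gen S a = left_ideal_gen S b}"

definition green_H :: "'a sgrp \<Rightarrow> ('a \<times> 'a) set" where
  "green_H S = green_R S \<inter> green_L S"

definition green_D :: "'a sgrp \<Rightarrow> ('a \<times> 'a) set" where
  "green_D S = green_R S O green_L S"

definition green_J :: "'a sgrp \<Rightarrow> ('a \<times> 'a) set" where
  "green_J S = {(a, b). a \<in> carrier S \<and> b \<in> carrier S \<and> ideal_gen S a = ideal_gen S b}"

text \<open>In a semigroup the order of composition in \<open>\<D>\<close> is immaterial.\<close>

lemma green_R_L_commute:
  assumes S: "is_semigroup S"
  shows "green_R S O green_L S = green_L S O green_R S"
proof -
  note cl = S[unfolded is_semigroup_def, THEN conjunct1, rule_format]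
  note as = S[unfolded is_semigroup_def, THEN conjunct2, rule_format]
  have Rc: "(mult S c a, mult S c b) \<in> green_R S"
    if "(a, b) \<in> green_R S" "c \<in> carrier S" for a b c
  proof -
    have ab: "a \<in> carrier S" "b \<in> carrier S" "right_ideal_gen S a = right_ideal_gen S b"
      using that by (auto simp: green_R_def)
    have *: "right_ideal_gen S (mult S c x) = mult S c ` right_ideal_gen S x" if "x \<in> carrier S" for x
      unfolding right_ideal_gen_def using that \<open>c \<in> carrier S\<close> by (force simp: as)
    show ?thesis using ab that cl by (simp add: green_R_def *)
  qed
  have Lc: "(mult S a c, mult S b c) \<in> green_L S"
    if "(a, b) \<in> green_L S" "c \<in> carrier S" for a b c
  proof -
    have ab: "a \<in> carrier S" "b \<in> carrier S" "left_ideal_gen S a = left_ideal_gen S b"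
      using that by (auto simp: green_L_def)
    have *: "left_ideal_gen S (mult S x c) = (\<lambda>y. mult S y c) ` left_ideal_gen S x" if "x \<in> carrier S" for x
      unfolding left_ideal_gen_def using that \<open>c \<in> carrier S\<close> by (force simp: as[symmetric])
    show ?thesis using ab that cl by (simp add: green_L_def *)
  qed
  have Rsym: "(b, a) \<in> green_R S" if "(a, b) \<in> green_R S" for a b
    using that by (auto simp: green_R_def)
  have Lsym: "(b, a) \<in> green_L S" if "(a, b) \<in> green_L S" for a b
    using that by (auto simp: green_L_def)
  have main: "(a, b) \<in> green_L S O green_R S" if h: "(a, c) \<in> green_R S" "(c, b) \<in> green_L S" for a b c
  proof -
    have car: "a \<in> carrier S" "b \<in> carrier S" "c \<in> carrier S" using h by (auto simp: green_R_def green_L_def)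
    have "a \<in> right_ideal_gen S c" using h(1) by (auto simp: green_R_def right_ideal_gen_def)
    then consider "a = c" | s where "s \<in> carrier S" "a = mult S c s" by (auto simp: right_ideal_gen_def)
    then show ?thesis
    proof cases
      case 1
      then show ?thesis using h car by (auto simp: green_R_def)
    next
      case s: 2
      have "b \<in> left_ideal_gen S c" using h(2) by (auto simp: green_L_def left_ideal_gen_def)
      then consider "b = c" | t where "t \<in> carrier S" "b = mult S t c" by (auto simp: left_ideal_gen_def)
      then show ?thesis
      proof cases
        case 1
        then show ?thesis using h car by (auto simp: green_L_def)
      next
        case t: 2
        have 1: "(a, mult S b s) \<in> green_L S" using Lc[OF h(2) s(1)] s by simp
        have "(mult S t a, b) \<in> green_R S" using Rc[OF h(1) t(1)] t by simp
        moreover have "mult S t a = mult S b s" using s t car by (simp add: as)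
        ultimately show ?thesis using 1 by auto
      qed
    qed
  qed
  have "green_R S O green_L S \<subseteq> green_L S O green_R S" using main by blast
  moreover have "green_L S O green_R S \<subseteq> green_R S O green_L S"
  proof clarify
    fix a b c assume "(a, c) \<in> green_L S" "(c, b) \<in> green_R S"
    then have "(b, a) \<in> green_L S O green_R S" using main Rsym Lsym by blast
    then show "(a, b) \<in> green_R S O green_L S" using Rsym Lsym by blast
  qed
  ultimately show ?thesis by blast
qed


section \<open>Rees quotients\<close>

definition is_ideal :: "'a sgrp \<Rightarrow> 'a set \<Rightarrow> bool" where
  "is_ideal S I \<longleftrightarrow> I \<subseteq> carrier S \<and>
     (\<forall>a\<in>I. \<forall>s\<in>carrier S. mult S a s \<in> I \<and> mult S s a \<in> I)"

text \<open>For \<open>I = {}\<close> this is equality on the carrier, so that \<open>S / {}\<close> is \<open>S\<close> itself, up to writing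
  \<open>{a}\<close> for \<open>a\<close>.\<close>

definition rees_cong :: "'a sgrp \<Rightarrow> 'a set \<Rightarrow> ('a \<times> 'a) set" where
  "rees_cong S I = Id_on (carrier S) \<union> I \<times> I"

definition rees_quotient :: "'a sgrp \<Rightarrow> 'a set \<Rightarrow> 'a set sgrp" where
  "rees_quotient S I =
     \<lparr>carrier = carrier S // rees_cong S I,
      mult = (\<lambda>A B. \<Union>a\<in>A. \<Union>b\<in>B. rees_cong S I `` {mult S a b})\<rparr>"

lemma rees_cong_equiv: "I \<subseteq> carrier S \<Longrightarrow> equiv (carrier S) (rees_cong S I)"
  by (rule equivI) (auto simp: rees_cong_def refl_on_def sym_def trans_def)

lemma rees_quotient_mult:
  assumes "is_semigroup S" "is_ideal S I" "a \<in> carrier S" "b \<in> carrier S"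
  shows "mult (rees_quotient S I) (rees_cong S I `` {a}) (rees_cong S I `` {b})
           = rees_cong S I `` {mult S a b}"
proof -
  have e: "equiv (carrier S) (rees_cong S I)"
    using assms rees_cong_equiv unfolding is_ideal_def by blast
  have "congruent2 (rees_cong S I) (rees_cong S I) (\<lambda>a b. rees_cong S I `` {mult S a b})"
    using assms(1,2) unfolding congruent2_def rees_cong_def is_semigroup_def is_ideal_def
    by (auto 0 4)
  from UN_equiv_class2[OF e e this assms(3,4)] show ?thesis
    by (simp add: rees_quotient_def)
qed

lemma rees_quotient_semigroup:
  assumes "is_semigroup S" "is_ideal S I"
  shows "is_semigroup (rees_quotient S I)"
proof -
  have c: "carrier (rees_quotient S I) = (\<lambda>a. rees_cong S I `` {a}) ` carrier S"
    by (auto simp: rees_quotient_def quotient_def)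
  show ?thesis
    using assms(1) unfolding is_semigroup_def c
    by (auto simp: rees_quotient_mult[OF assms])
qed


section \<open>The semigroup \<open>B\<^sub>\<omega>\<close> extended by a family of sets\<close>

definition shift :: "int \<Rightarrow> nat set \<Rightarrow> int set" where
  "shift n F = (\<lambda>k. n + int k) ` F"

text \<open>Subsets of \<open>\<omega>\<close> have type \<open>nat set\<close> while \<open>n + F\<close> is a set of integers, so the
  intersection with a subset of \<open>\<omega>\<close> is taken after pulling \<open>n + F\<close> back along \<open>int\<close>.\<close>

definition omega_closed :: "nat set set \<Rightarrow> bool" where
  "omega_closed \<F> \<longleftrightarrow> (\<forall>n. \<forall>F1\<in>\<F>. \<forall>F2\<in>\<F>. F1 \<inter> int -` shift (- int n) F2 \<in> \<F>)"

type_synonym triple = "nat \<times> nat \<times> nat set"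

text \<open>The guards rule out truncation of the natural-number subtractions.\<close>

fun B_mult :: "triple \<Rightarrow> triple \<Rightarrow> triple" where
  "B_mult (i1, j1, F1) (i2, j2, F2) =
     (if j1 \<le> i2
      then (i1 + i2 - j1, j2, int -` shift (int j1 - int i2) F1 \<inter> F2)
      else (i1, j1 + j2 - i2, F1 \<inter> int -` shift (int i2 - int j1) F2))"

text \<open>At \<open>j1 = i2\<close> the two branches agree.\<close>

lemma B_mult_ge:
  "i2 \<le> j1 \<Longrightarrow> B_mult (i1, j1, F1) (i2, j2, F2) =
     (i1, j1 + j2 - i2, F1 \<inter> int -` shift (int i2 - int j1) F2)"
  by (auto simp: shift_def)

definition B_times :: "nat set set \<Rightarrow> triple sgrp" where
  "B_times \<F> = \<lparr>carrier = UNIV \<times> UNIV \<times> \<F>, mult = B_mult\<rparr>"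

text \<open>This set is empty if \<open>{} \<notin> \<F>\<close>.\<close>

definition B_ideal :: "nat set set \<Rightarrow> triple set" where
  "B_ideal \<F> = {(i, j, F). F \<in> \<F> \<and> F = {}}"

text \<open>If \<open>{} \<in> \<F>\<close> this is the Rees quotient by \<open>B_ideal \<F>\<close>; if \<open>{} \<notin> \<F>\<close> it is \<open>B_times \<F>\<close>,
  with \<open>{x}\<close> written for \<open>x\<close> (lemmas \<open>B_elem_no_zero\<close> and \<open>B_elem_iso\<close> below).\<close>

definition B_sgrp :: "nat set set \<Rightarrow> triple set sgrp" where
  "B_sgrp \<F> = rees_quotient (B_times \<F>) (B_ideal \<F>)"

text \<open>The element of \<open>B_sgrp \<F>\<close> denoted by a triple.\<close>

definition B_elem :: "nat set set \<Rightarrow> triple \<Rightarrow> triple set" where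
  "B_elem \<F> x = rees_cong (B_times \<F>) (B_ideal \<F>) `` {x}"

lemma vimage_shift:
  assumes "j \<le> i"
  shows "int -` shift (int j - int i) F = {k. k + (i - j) \<in> F}"
proof -
  have "int k = int j - int i + int m \<longleftrightarrow> m = k + (i - j)" for k m
    using assms by arith
  then show ?thesis by (auto simp: shift_def image_iff)
qed

lemma omega_closed_alt:
  "omega_closed \<F> \<longleftrightarrow> (\<forall>n. \<forall>F1\<in>\<F>. \<forall>F2\<in>\<F>. F1 \<inter> {k. k + n \<in> F2} \<in> \<F>)"
  using vimage_shift[of 0] by (simp add: omega_closed_def)

lemma B_mult_alt:
  "B_mult (i1, j1, F1) (i2, j2, F2) =
     (if j1 \<le> i2
      then (i1 + (i2 - j1), j2, {k. k + (i2 - j1) \<in> F1} \<inter> F2)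
      else (i1, (j1 - i2) + j2, F1 \<inter> {k. k + (j1 - i2) \<in> F2}))"
  by (simp add: vimage_shift)

lemma B_mult_assoc: "B_mult (B_mult x y) z = B_mult x (B_mult y z)"
proof -
  obtain i1 j1 F1 i2 j2 F2 i3 j3 F3
    where xyz: "x = (i1, j1, F1)" "y = (i2, j2, F2)" "z = (i3, j3, F3)"
    by (metis prod_cases3)
  have dich: "(\<exists>d. b = a + d) \<or> (\<exists>d. a = b + Suc d)" for a b :: nat
    by presburger
  note sets = Int_def ac_simps
  consider d e where "i2 = j1 + d" "i3 = j2 + e"
    | d e where "i2 = j1 + d" "j2 = i3 + Suc e"
    | d e where "j1 = i2 + Suc d" "i3 = j2 + e"
    | d e where "j1 = i2 + Suc d" "j2 = i3 + Suc e"
    using dich[of i2 j1] dich[of i3 j2] by blast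
  then show ?thesis
  proof cases
    case 1
    then show ?thesis by (simp add: xyz B_mult_alt sets del: B_mult.simps)
  next
    case 2
    then show ?thesis by (simp add: xyz B_mult_alt sets del: B_mult.simps)
  next
    case 3
    then show ?thesis by (simp add: xyz B_mult_alt sets del: B_mult.simps)
  next
    case 4
    then show ?thesis by (simp add: xyz B_mult_alt sets del: B_mult.simps)
  qed
qed

lemma B_times_semigroup:
  assumes "omega_closed \<F>"
  shows "is_semigroup (B_times \<F>)"
  using assms unfolding is_semigroup_def B_times_def
  by (auto simp: B_mult_assoc B_mult_alt omega_closed_alt Int_commute
      simp del: B_mult.simps Nat.add_diff_assoc)

lemma B_ideal_is_ideal: "omega_closed \<F> \<Longrightarrow> is_ideal (B_times \<F>) (B_ideal \<F>)"
  unfolding is_ideal_def B_ideal_def B_times_def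
  by (auto simp: B_mult_alt simp del: B_mult.simps)

lemma B_sgrp_semigroup: "omega_closed \<F> \<Longrightarrow> is_semigroup (B_sgrp \<F>)"
  unfolding B_sgrp_def by (intro rees_quotient_semigroup B_times_semigroup B_ideal_is_ideal)

lemma B_elem_mult:
  "omega_closed \<F> \<Longrightarrow> x \<in> carrier (B_times \<F>) \<Longrightarrow> y \<in> carrier (B_times \<F>) \<Longrightarrow>
     mult (B_sgrp \<F>) (B_elem \<F> x) (B_elem \<F> y) = B_elem \<F> (B_mult x y)"
  unfolding B_sgrp_def B_elem_def
  by (simp add: rees_quotient_mult B_times_semigroup B_ideal_is_ideal) (simp add: B_times_def)

lemma B_sgrp_carrier: "carrier (B_sgrp \<F>) = B_elem \<F> ` (UNIV \<times> UNIV \<times> \<F>)"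
  by (auto simp: B_sgrp_def B_elem_def rees_quotient_def quotient_def B_times_def)

lemma B_elem_nonzero: "F \<in> \<F> \<Longrightarrow> F \<noteq> {} \<Longrightarrow> B_elem \<F> (i, j, F) = {(i, j, F)}"
  by (auto simp: B_elem_def rees_cong_def B_ideal_def B_times_def)

lemma B_elem_zero: "{} \<in> \<F> \<Longrightarrow> B_elem \<F> (i, j, {}) = B_ideal \<F>"
  by (auto simp: B_elem_def rees_cong_def B_ideal_def B_times_def)

lemma B_elem_no_zero:
  "{} \<notin> \<F> \<Longrightarrow> x \<in> carrier (B_times \<F>) \<Longrightarrow> B_elem \<F> x = {x}"
  by (cases x) (auto simp: B_times_def intro!: B_elem_nonzero)

lemma B_elem_iso:
  assumes "omega_closed \<F>" "{} \<notin> \<F>"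
  shows "bij_betw (B_elem \<F>) (carrier (B_times \<F>)) (carrier (B_sgrp \<F>))"
    and "x \<in> carrier (B_times \<F>) \<Longrightarrow> y \<in> carrier (B_times \<F>) \<Longrightarrow>
           B_elem \<F> (mult (B_times \<F>) x y) = mult (B_sgrp \<F>) (B_elem \<F> x) (B_elem \<F> y)"
proof -
  show "bij_betw (B_elem \<F>) (carrier (B_times \<F>)) (carrier (B_sgrp \<F>))"
    using B_elem_no_zero[OF assms(2)]
    by (auto simp: bij_betw_def inj_on_def B_sgrp_carrier B_times_def simp del: split_paired_All)
  show "B_elem \<F> (mult (B_times \<F>) x y) = mult (B_sgrp \<F>) (B_elem \<F> x) (B_elem \<F> y)"
    if "x \<in> carrier (B_times \<F>)" "y \<in> carrier (B_times \<F>)"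
    using B_elem_mult[OF assms(1) that] by (simp add: B_times_def)
qed

end

theory Submission
  imports Defs
begin

text \<open>
  All five relations compare principal ideals, so everything reduces to deciding when a non-zero
  triple lies in the principal ideal generated by another one. Multiplying \<open>(i, j, F)\<close> on the right
  either keeps \<open>i\<close> and shrinks \<open>F\<close>, or raises \<open>i\<close> by some \<open>d\<close>
  and shrinks the translate \<open>-d + F\<close>; every non-zero triple of this shape is attained, since the
  factor can carry the wanted set itself. Hence a non-zero \<open>(i\<^sub>1, j\<^sub>1, F\<^sub>1)\<close> lies in the right ideal
  of \<open>(i\<^sub>2, j\<^sub>2, F\<^sub>2)\<close> exactly if \<open>i\<^sub>2 \<le> i\<^sub>1\<close> and \<open>F\<^sub>1 \<subseteq> -(i\<^sub>1 - i\<^sub>2) + F\<^sub>2\<close>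
  (\<open>B_mem_right_ideal\<close>), dually for left ideals and the second coordinate (\<open>B_mem_left_ideal\<close>).
  Mutual divisibility therefore forces the translation to be by \<open>0\<close> and the sets to be equal,
  which gives \<open>\<R>\<close> and \<open>\<L>\<close>, and then \<open>\<H>\<close> and \<open>\<D>\<close>.

  For two-sided ideals the coordinates can be adjusted freely and only the condition on the sets
  survives, with an arbitrary translation (\<open>B_mem_ideal\<close>). Here two translations, one for each
  direction, need not be \<open>0\<close>, and so \<open>\<J>\<close> does not force the sets to be equal.

  The zero element causes no trouble: the set of a divisor contains a translate of the set of the
  multiple, so a divisor of a non-zero element is non-zero.
\<close>

section \<open>Green's relations through membership in principal ideals\<close>

lemma right_ideal_gen_subset_iff:
  assumes S: "is_semigroup S" and "a \<in> carrier S" "b \<in> carrier S"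
  shows "right_ideal_gen S a \<subseteq> right_ideal_gen S b \<longleftrightarrow> a \<in> right_ideal_gen S b"
proof
  note cl = S[unfolded is_semigroup_def, THEN conjunct1, rule_format]
  note as = S[unfolded is_semigroup_def, THEN conjunct2, rule_format]
  assume "a \<in> right_ideal_gen S b"
  then show "right_ideal_gen S a \<subseteq> right_ideal_gen S b"
    using assms(2,3) by (auto simp: right_ideal_gen_def as intro: cl)
qed (auto simp: right_ideal_gen_def)

lemma left_ideal_gen_subset_iff:
  assumes S: "is_semigroup S" and "a \<in> carrier S" "b \<in> carrier S"
  shows "left_ideal_gen S a \<subseteq> left_ideal_gen S b \<longleftrightarrow> a \<in> left_ideal_gen S b"
proof
  note cl = S[unfolded is_semigroup_def, THEN conjunct1, rule_format]
  note as = S[unfolded is_semigroup_def, THEN conjunct2, rule_format]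
  assume "a \<in> left_ideal_gen S b"
  then show "left_ideal_gen S a \<subseteq> left_ideal_gen S b"
    using assms(2,3) by (auto simp: left_ideal_gen_def as[symmetric] intro: cl)
qed (auto simp: left_ideal_gen_def)

text \<open>A two-sided multiple is a left multiple of a right multiple; this lets the facts on one-sided
  ideals be reused for two-sided ones.\<close>

lemma mem_ideal_gen_iff:
  assumes S: "is_semigroup S" and "b \<in> carrier S"
  shows "a \<in> ideal_gen S b \<longleftrightarrow> (\<exists>c\<in>right_ideal_gen S b. a \<in> left_ideal_gen S c)"
proof -
  note as = S[unfolded is_semigroup_def, THEN conjunct2, rule_format]
  have "{mult S (mult S s b) t | s t. s \<in> carrier S \<and> t \<in> carrier S}
      = {mult S s (mult S b t) | s t. s \<in> carrier S \<and> t \<in> carrier S}"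
    using as[OF _ assms(2)] by (intro Collect_cong ex_cong1) auto
  then show ?thesis
    unfolding ideal_gen_def right_ideal_gen_def left_ideal_gen_def by blast
qed

lemma right_ideal_gen_carrier:
  "is_semigroup S \<Longrightarrow> b \<in> carrier S \<Longrightarrow> right_ideal_gen S b \<subseteq> carrier S"
  by (auto simp: right_ideal_gen_def is_semigroup_def)

lemma ideal_gen_subset_iff:
  assumes S: "is_semigroup S" and ab: "a \<in> carrier S" "b \<in> carrier S"
  shows "ideal_gen S a \<subseteq> ideal_gen S b \<longleftrightarrow> a \<in> ideal_gen S b"
proof
  note cl = S[unfolded is_semigroup_def, THEN conjunct1, rule_format]
  note as = S[unfolded is_semigroup_def, THEN conjunct2, rule_format]
  have step: "mult S x t \<in> ideal_gen S b \<and> mult S t x \<in> ideal_gen S b"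
    if "x \<in> ideal_gen S b" "t \<in> carrier S" for x t
    using that(1)[unfolded ideal_gen_def]
  proof (elim UnE CollectE exE conjE singletonE)
    assume "x = b"
    then show ?thesis using that(2) by (auto simp: ideal_gen_def)
  next
    fix u assume "x = mult S b u" "u \<in> carrier S"
    then have "mult S x t = mult S b (mult S u t)" "mult S t x = mult S (mult S t b) u"
      using ab that(2) by (simp_all add: as)
    then show ?thesis
      using cl[OF \<open>u \<in> carrier S\<close> that(2)] \<open>u \<in> carrier S\<close> that(2) by (auto simp: ideal_gen_def)
  next
    fix s assume "x = mult S s b" "s \<in> carrier S"
    then have "mult S x t = mult S (mult S s b) t" "mult S t x = mult S (mult S t s) b"
      using ab that(2) by (simp_all add: as)
    then show ?thesis
      using cl[OF that(2) \<open>s \<in> carrier S\<close>] \<open>s \<in> carrier S\<close> that(2) by (auto simp: ideal_gen_def)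
  next
    fix s u assume "x = mult S (mult S s b) u" "s \<in> carrier S" "u \<in> carrier S"
    then have "mult S x t = mult S (mult S s b) (mult S u t)"
      "mult S t x = mult S (mult S (mult S t s) b) u"
      using ab that(2) by (simp_all add: as cl)
    then show ?thesis
      using cl[OF \<open>u \<in> carrier S\<close> that(2)] cl[OF that(2) \<open>s \<in> carrier S\<close>]
        \<open>s \<in> carrier S\<close> \<open>u \<in> carrier S\<close> that(2)
      unfolding ideal_gen_def by blast
  qed
  assume "a \<in> ideal_gen S b"
  then show "ideal_gen S a \<subseteq> ideal_gen S b"
    unfolding ideal_gen_def[of S a] using step by blast
qed (auto simp: ideal_gen_def)


section \<open>Divisibility in the extended bicyclic semigroup\<close>

lemma B_elem_in_carrier: "F \<in> \<F> \<Longrightarrow> B_elem \<F> (i, j, F) \<in> carrier (B_sgrp \<F>)"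
  by (simp add: B_sgrp_carrier)

lemma B_carrierE:
  assumes "c \<in> carrier (B_sgrp \<F>)"
  obtains i j F where "c = B_elem \<F> (i, j, F)" "F \<in> \<F>"
  using assms by (auto simp: B_sgrp_carrier)

lemma B_elem_inject:
  assumes "B_elem \<F> (i1, j1, F1) = B_elem \<F> x" "F1 \<in> \<F>" "F1 \<noteq> {}"
  shows "x = (i1, j1, F1)"
proof -
  have "(i1, j1, F1) \<in> B_elem \<F> x"
    using assms by (simp add: B_elem_nonzero flip: assms(1))
  then show ?thesis
    using \<open>F1 \<noteq> {}\<close> by (auto simp: B_elem_def rees_cong_def B_ideal_def)
qed

lemma B_elem_mult_triples:
  assumes "omega_closed \<F>" "F \<in> \<F>" "G \<in> \<F>"
  shows "mult (B_sgrp \<F>) (B_elem \<F> (i, j, F)) (B_elem \<F> (k, l, G))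
       = B_elem \<F> (B_mult (i, j, F) (k, l, G))"
  using assms by (intro B_elem_mult) (auto simp: B_times_def)

text \<open>Sufficiency uses the factor \<open>(j\<^sub>2 + (i\<^sub>1 - i\<^sub>2), j\<^sub>1, F\<^sub>1)\<close>: it raises the first coordinate to
  \<open>i\<^sub>1\<close> and cuts the translate of \<open>F\<^sub>2\<close> down to \<open>F\<^sub>1\<close>.\<close>

lemma B_mem_right_ideal:
  assumes "omega_closed \<F>" "F1 \<in> \<F>" "F1 \<noteq> {}" "F2 \<in> \<F>"
  shows "B_elem \<F> (i1, j1, F1) \<in> right_ideal_gen (B_sgrp \<F>) (B_elem \<F> (i2, j2, F2)) \<longleftrightarrow>
     i2 \<le> i1 \<and> F1 \<subseteq> {k. k + (i1 - i2) \<in> F2}"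
proof
  assume "B_elem \<F> (i1, j1, F1) \<in> right_ideal_gen (B_sgrp \<F>) (B_elem \<F> (i2, j2, F2))"
  then consider "B_elem \<F> (i1, j1, F1) = B_elem \<F> (i2, j2, F2)"
    | s where "s \<in> carrier (B_sgrp \<F>)"
        "B_elem \<F> (i1, j1, F1) = mult (B_sgrp \<F>) (B_elem \<F> (i2, j2, F2)) s"
    by (auto simp: right_ideal_gen_def)
  then show "i2 \<le> i1 \<and> F1 \<subseteq> {k. k + (i1 - i2) \<in> F2}"
  proof cases
    case 1
    from B_elem_inject[OF this assms(2,3)] show ?thesis by auto
  next
    case 2
    obtain i j F where s: "s = B_elem \<F> (i, j, F)" "F \<in> \<F>"
      using 2(1) by (rule B_carrierE)
    have "B_mult (i2, j2, F2) (i, j, F) = (i1, j1, F1)"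
      using 2(2) s assms by (auto simp: B_elem_mult_triples simp del: B_mult.simps intro: B_elem_inject)
    then show ?thesis
      by (auto simp: B_mult_alt simp del: B_mult.simps split: if_splits)
  qed
next
  assume h: "i2 \<le> i1 \<and> F1 \<subseteq> {k. k + (i1 - i2) \<in> F2}"
  then have "B_mult (i2, j2, F2) (j2 + (i1 - i2), j1, F1) = (i1, j1, F1)"
    by (auto simp: B_mult_alt simp del: B_mult.simps)
  then have "mult (B_sgrp \<F>) (B_elem \<F> (i2, j2, F2)) (B_elem \<F> (j2 + (i1 - i2), j1, F1))
      = B_elem \<F> (i1, j1, F1)"
    using assms by (simp add: B_elem_mult_triples del: B_mult.simps)
  then show "B_elem \<F> (i1, j1, F1) \<in> right_ideal_gen (B_sgrp \<F>) (B_elem \<F> (i2, j2, F2))"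
    using B_elem_in_carrier[OF assms(2)] unfolding right_ideal_gen_def by blast
qed

text \<open>The mirror image, with the factor \<open>(i\<^sub>1, i\<^sub>2 + (j\<^sub>1 - j\<^sub>2), F\<^sub>1)\<close>.\<close>

lemma B_mem_left_ideal:
  assumes "omega_closed \<F>" "F1 \<in> \<F>" "F1 \<noteq> {}" "F2 \<in> \<F>"
  shows "B_elem \<F> (i1, j1, F1) \<in> left_ideal_gen (B_sgrp \<F>) (B_elem \<F> (i2, j2, F2)) \<longleftrightarrow>
     j2 \<le> j1 \<and> F1 \<subseteq> {k. k + (j1 - j2) \<in> F2}"
proof
  assume "B_elem \<F> (i1, j1, F1) \<in> left_ideal_gen (B_sgrp \<F>) (B_elem \<F> (i2, j2, F2))"
  then consider "B_elem \<F> (i1, j1, F1) = B_elem \<F> (i2, j2, F2)"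
    | s where "s \<in> carrier (B_sgrp \<F>)"
        "B_elem \<F> (i1, j1, F1) = mult (B_sgrp \<F>) s (B_elem \<F> (i2, j2, F2))"
    by (auto simp: left_ideal_gen_def)
  then show "j2 \<le> j1 \<and> F1 \<subseteq> {k. k + (j1 - j2) \<in> F2}"
  proof cases
    case 1
    from B_elem_inject[OF this assms(2,3)] show ?thesis by auto
  next
    case 2
    obtain i j F where s: "s = B_elem \<F> (i, j, F)" "F \<in> \<F>"
      using 2(1) by (rule B_carrierE)
    have "B_mult (i, j, F) (i2, j2, F2) = (i1, j1, F1)"
      using 2(2) s assms by (auto simp: B_elem_mult_triples simp del: B_mult.simps intro: B_elem_inject)
    then show ?thesis
      by (auto simp: B_mult_alt simp del: B_mult.simps split: if_splits)
  qed
next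
  assume h: "j2 \<le> j1 \<and> F1 \<subseteq> {k. k + (j1 - j2) \<in> F2}"
  then have "B_mult (i1, i2 + (j1 - j2), F1) (i2, j2, F2) = (i1, j1, F1)"
    by (auto simp: B_mult_alt simp del: B_mult.simps)
  then have "mult (B_sgrp \<F>) (B_elem \<F> (i1, i2 + (j1 - j2), F1)) (B_elem \<F> (i2, j2, F2))
      = B_elem \<F> (i1, j1, F1)"
    using assms by (simp add: B_elem_mult_triples del: B_mult.simps)
  then show "B_elem \<F> (i1, j1, F1) \<in> left_ideal_gen (B_sgrp \<F>) (B_elem \<F> (i2, j2, F2))"
    using B_elem_in_carrier[OF assms(2)] unfolding left_ideal_gen_def by blast
qed

text \<open>Translations by the two one-sided steps add up. Conversely, a translation by \<open>k\<close> is
  realised by passing through \<open>(i\<^sub>2 + k, j\<^sub>1, F\<^sub>1)\<close>: a right multiple of the generator, which a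
  further left multiplication takes to \<open>(i\<^sub>1, j\<^sub>1, F\<^sub>1)\<close> because left multiples leave the first
  coordinate arbitrary.\<close>

lemma B_mem_ideal:
  assumes "omega_closed \<F>" "F1 \<in> \<F>" "F1 \<noteq> {}" "F2 \<in> \<F>"
  shows "B_elem \<F> (i1, j1, F1) \<in> ideal_gen (B_sgrp \<F>) (B_elem \<F> (i2, j2, F2)) \<longleftrightarrow>
     (\<exists>k. F1 \<subseteq> {x. x + k \<in> F2})"
proof -
  let ?S = "B_sgrp \<F>"
  note sg = B_sgrp_semigroup[OF assms(1)]
  note mem = mem_ideal_gen_iff[OF sg B_elem_in_carrier[OF assms(4)]]
  show ?thesis
  proof
    assume "B_elem \<F> (i1, j1, F1) \<in> ideal_gen ?S (B_elem \<F> (i2, j2, F2))"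
    then obtain c where c: "c \<in> right_ideal_gen ?S (B_elem \<F> (i2, j2, F2))"
        "B_elem \<F> (i1, j1, F1) \<in> left_ideal_gen ?S c"
      unfolding mem by blast
    then have "c \<in> carrier ?S"
      using right_ideal_gen_carrier[OF sg B_elem_in_carrier[OF assms(4)]] by blast
    then obtain i j F where F: "c = B_elem \<F> (i, j, F)" "F \<in> \<F>"
      by (rule B_carrierE)
    have left: "F1 \<subseteq> {k. k + (j1 - j) \<in> F}"
      using c(2) F assms by (simp add: B_mem_left_ideal del: Nat.add_diff_assoc)
    with assms(3) have "F \<noteq> {}" by blast
    then have "F \<subseteq> {k. k + (i - i2) \<in> F2}"
      using c(1) F assms by (simp add: B_mem_right_ideal del: Nat.add_diff_assoc)
    with left have "F1 \<subseteq> {k. k + ((j1 - j) + (i - i2)) \<in> F2}"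
      by (auto simp: add.assoc[symmetric] simp del: Nat.add_diff_assoc)
    then show "\<exists>k. F1 \<subseteq> {x. x + k \<in> F2}" by blast
  next
    assume "\<exists>k. F1 \<subseteq> {x. x + k \<in> F2}"
    then obtain k where k: "F1 \<subseteq> {x. x + k \<in> F2}" by blast
    have "B_elem \<F> (i2 + k, j1, F1) \<in> right_ideal_gen ?S (B_elem \<F> (i2, j2, F2))"
      using k assms by (simp add: B_mem_right_ideal)
    moreover have "B_elem \<F> (i1, j1, F1) \<in> left_ideal_gen ?S (B_elem \<F> (i2 + k, j1, F1))"
      using assms by (simp add: B_mem_left_ideal)
    ultimately show "B_elem \<F> (i1, j1, F1) \<in> ideal_gen ?S (B_elem \<F> (i2, j2, F2))"
      unfolding mem by blast
  qed
qed


section \<open>Green's relations\<close>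

text \<open>Only one of the two sets is assumed to be nonempty, which makes the equivalence also say
  that a non-zero element is never related to the zero. This is what excludes zero as the
  intermediate element in \<open>\<D>\<close>, and non-zero elements from the \<open>\<H>\<close>-class of zero.\<close>

lemma B_green_R_iff:
  assumes "omega_closed \<F>" "F1 \<in> \<F>" "F1 \<noteq> {}" "F2 \<in> \<F>"
  shows "(B_elem \<F> (i1, j1, F1), B_elem \<F> (i2, j2, F2)) \<in> green_R (B_sgrp \<F>)
     \<longleftrightarrow> i1 = i2 \<and> F1 = F2" (is "?rel \<longleftrightarrow> _")
proof -
  note sg = B_sgrp_semigroup[OF assms(1)]
  have rel: "?rel \<longleftrightarrow>
      B_elem \<F> (i1, j1, F1) \<in> right_ideal_gen (B_sgrp \<F>) (B_elem \<F> (i2, j2, F2)) \<and>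
      B_elem \<F> (i2, j2, F2) \<in> right_ideal_gen (B_sgrp \<F>) (B_elem \<F> (i1, j1, F1))"
    using assms
    by (simp add: green_R_def set_eq_subset[of "right_ideal_gen _ _"]
        right_ideal_gen_subset_iff[OF sg] B_elem_in_carrier)
  show ?thesis
  proof (cases "F2 = {}")
    case True
    with assms rel show ?thesis by (auto simp: B_mem_right_ideal)
  next
    case False
    with assms show ?thesis unfolding rel by (auto simp: B_mem_right_ideal)
  qed
qed

lemma B_green_L_iff:
  assumes "omega_closed \<F>" "F1 \<in> \<F>" "F1 \<noteq> {}" "F2 \<in> \<F>"
  shows "(B_elem \<F> (i1, j1, F1), B_elem \<F> (i2, j2, F2)) \<in> green_L (B_sgrp \<F>)
     \<longleftrightarrow> j1 = j2 \<and> F1 = F2" (is "?rel \<longleftrightarrow> _")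
proof -
  note sg = B_sgrp_semigroup[OF assms(1)]
  have rel: "?rel \<longleftrightarrow>
      B_elem \<F> (i1, j1, F1) \<in> left_ideal_gen (B_sgrp \<F>) (B_elem \<F> (i2, j2, F2)) \<and>
      B_elem \<F> (i2, j2, F2) \<in> left_ideal_gen (B_sgrp \<F>) (B_elem \<F> (i1, j1, F1))"
    using assms
    by (simp add: green_L_def set_eq_subset[of "left_ideal_gen _ _"]
        left_ideal_gen_subset_iff[OF sg] B_elem_in_carrier)
  show ?thesis
  proof (cases "F2 = {}")
    case True
    with assms rel show ?thesis by (auto simp: B_mem_left_ideal)
  next
    case False
    with assms show ?thesis unfolding rel by (auto simp: B_mem_left_ideal)
  qed
qed

lemma B_green_H_iff:
  assumes "omega_closed \<F>" "F1 \<in> \<F>" "F1 \<noteq> {}" "F2 \<in> \<F>"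
  shows "(B_elem \<F> (i1, j1, F1), B_elem \<F> (i2, j2, F2)) \<in> green_H (B_sgrp \<F>)
     \<longleftrightarrow> i1 = i2 \<and> j1 = j2 \<and> F1 = F2"
  using assms by (auto simp: green_H_def B_green_R_iff B_green_L_iff)

lemma B_green_H_subset_Id:
  assumes "omega_closed \<F>" and ab: "(a, b) \<in> green_H (B_sgrp \<F>)"
  shows "a = b"
proof -
  have "a \<in> carrier (B_sgrp \<F>)" "b \<in> carrier (B_sgrp \<F>)"
    and ba: "(b, a) \<in> green_H (B_sgrp \<F>)"
    using ab by (auto simp: green_H_def green_R_def green_L_def)
  then obtain i1 j1 F1 i2 j2 F2 where a: "a = B_elem \<F> (i1, j1, F1)" "F1 \<in> \<F>"
      and b: "b = B_elem \<F> (i2, j2, F2)" "F2 \<in> \<F>"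
    by (metis B_carrierE)
  consider "F1 \<noteq> {}" | "F2 \<noteq> {}" | "F1 = {}" "F2 = {}" by blast
  then show ?thesis
  proof cases
    case 1
    with ab a b assms(1) show ?thesis by (simp add: B_green_H_iff)
  next
    case 2
    with ba a b assms(1) show ?thesis by (simp add: B_green_H_iff)
  next
    case 3
    with a b show ?thesis by (simp add: B_elem_zero)
  qed
qed

lemma B_green_D_iff:
  assumes "omega_closed \<F>" "F1 \<in> \<F>" "F1 \<noteq> {}" "F2 \<in> \<F>"
  shows "(B_elem \<F> (i1, j1, F1), B_elem \<F> (i2, j2, F2)) \<in> green_D (B_sgrp \<F>)
     \<longleftrightarrow> F1 = F2"
proof
  assume "(B_elem \<F> (i1, j1, F1), B_elem \<F> (i2, j2, F2)) \<in> green_D (B_sgrp \<F>)"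
  then obtain c where c: "(B_elem \<F> (i1, j1, F1), c) \<in> green_R (B_sgrp \<F>)"
      "(c, B_elem \<F> (i2, j2, F2)) \<in> green_L (B_sgrp \<F>)"
    by (auto simp: green_D_def)
  then have "c \<in> carrier (B_sgrp \<F>)" by (auto simp: green_R_def)
  then obtain i j F where F: "c = B_elem \<F> (i, j, F)" "F \<in> \<F>"
    by (rule B_carrierE)
  have "F1 = F" using c(1) F assms by (simp add: B_green_R_iff)
  then show "F1 = F2" using c(2) F assms by (simp add: B_green_L_iff)
next
  assume "F1 = F2"
  then have "(B_elem \<F> (i1, j1, F1), B_elem \<F> (i1, j2, F1)) \<in> green_R (B_sgrp \<F>)"
    "(B_elem \<F> (i1, j2, F1), B_elem \<F> (i2, j2, F2)) \<in> green_L (B_sgrp \<F>)"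
    using assms by (simp_all add: B_green_R_iff B_green_L_iff)
  then show "(B_elem \<F> (i1, j1, F1), B_elem \<F> (i2, j2, F2)) \<in> green_D (B_sgrp \<F>)"
    by (auto simp: green_D_def)
qed

lemma B_green_J_iff:
  assumes "omega_closed \<F>" "F1 \<in> \<F>" "F1 \<noteq> {}" "F2 \<in> \<F>" "F2 \<noteq> {}"
  shows "(B_elem \<F> (i1, j1, F1), B_elem \<F> (i2, j2, F2)) \<in> green_J (B_sgrp \<F>)
     \<longleftrightarrow> (\<exists>k1 k2. F1 \<subseteq> {x. x + k1 \<in> F2} \<and> F2 \<subseteq> {x. x + k2 \<in> F1})"
  using assms
  by (simp add: green_J_def set_eq_subset[of "ideal_gen _ _"]
      ideal_gen_subset_iff[OF B_sgrp_semigroup[OF assms(1)]]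
      B_elem_in_carrier B_mem_ideal)

lemma int_image_subset_shift_iff:
  "int ` F \<subseteq> shift (- int k) G \<longleftrightarrow> F \<subseteq> {x. x + k \<in> G}"
  using vimage_shift[of 0 k G] by (auto simp: image_subset_iff_subset_vimage)

theorem mainTheorem1:
  fixes \<F> :: "nat set set" and i1 j1 i2 j2 :: nat and F1 F2 :: "nat set"
  assumes "\<F> \<noteq> {}" and "omega_closed \<F>"
    and "F1 \<in> \<F>" and "F1 \<noteq> {}" and "F2 \<in> \<F>" and "F2 \<noteq> {}"
  shows
    "((B_elem \<F> (i1, j1, F1), B_elem \<F> (i2, j2, F2)) \<in> green_R (B_sgrp \<F>)
        \<longleftrightarrow> i1 = i2 \<and> F1 = F2)
     \<and> ((B_elem \<F> (i1, j1, F1), B_elem \<F> (i2, j2, F2)) \<in> green_L (B_sgrp \<F>)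
        \<longleftrightarrow> j1 = j2 \<and> F1 = F2)
     \<and> ((B_elem \<F> (i1, j1, F1), B_elem \<F> (i2, j2, F2)) \<in> green_H (B_sgrp \<F>)
        \<longleftrightarrow> i1 = i2 \<and> j1 = j2 \<and> F1 = F2)
     \<and> (\<forall>C \<in> carrier (B_sgrp \<F>) // green_H (B_sgrp \<F>). \<exists>x. C = {x})
     \<and> ((B_elem \<F> (i1, j1, F1), B_elem \<F> (i2, j2, F2)) \<in> green_D (B_sgrp \<F>)
        \<longleftrightarrow> F1 = F2)
     \<and> ((B_elem \<F> (i1, j1, F1), B_elem \<F> (i2, j2, F2)) \<in> green_J (B_sgrp \<F>)
        \<longleftrightarrow> (\<exists>k1 k2 :: nat. int ` F1 \<subseteq> shift (- int k1) F2 \<and> int ` F2 \<subseteq> shift (- int k2) F1))"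
proof (intro conjI)
  show "\<forall>C \<in> carrier (B_sgrp \<F>) // green_H (B_sgrp \<F>). \<exists>x. C = {x}"
  proof
    fix C assume "C \<in> carrier (B_sgrp \<F>) // green_H (B_sgrp \<F>)"
    then obtain a where a: "a \<in> carrier (B_sgrp \<F>)" "C = green_H (B_sgrp \<F>) `` {a}"
      by (rule quotientE)
    have "(a, a) \<in> green_H (B_sgrp \<F>)"
      using a(1) by (simp add: green_H_def green_R_def green_L_def)
    with a(2) B_green_H_subset_Id[OF assms(2)] have "C = {a}" by blast
    then show "\<exists>x. C = {x}" ..
  qed
qed (use assms in \<open>simp_all add: B_green_R_iff B_green_L_iff B_green_H_iff B_green_D_iff
      B_green_J_iff int_image_subset_shift_iff\<close>)

end
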